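(* Let $S=S(G,\sigma)$ be a signed graph with underlying graph $G$ (finite, simple, undirected and connected). Then: (i) $M_1(G)=M_1^+(S)+M_1^-(S)+2M_1^{\ast}(S)$; (ii) $M_2(G)=M_2^+(S)+M_2^-(S)+M_2^{\ast}(S)$.
   Context: All graphs are finite, simple, undirected and connected. A signed graph $S=S(G,\sigma)$ is a graph $G$ with vertex set $V(G)=\{v_1,\dots,v_n\}$ and edge set $E(G)$ together with a function $\sigma:E(G)\to\{+,-\}$; $G$ is its underlying graph, and $V(S)=V(G)$, $E(S)=E(G)$. For a vertex $v_i$, $d_i=d_G(v_i)$ is its degree in $G$, $d_i^+=d_S^+(v_i)$ is the number of positive edges incident with $v_i$, and $d_i^-=d_S^-(v_i)$ is the number of negative edges incident with $v_i$. First and second Zagreb indices of $G$: $M_1(G)=\sum_{v_i\in V(G)}d_i^2$ and $M_2(G)=\sum_{v_iv_j\in E(G)}d_id_j$ (each edge counted once). First Zagreb indices of $S$: $M_1^+(S)=\sum_{v_i\in V(G)}(d_i^+)^2$ (positive), $M_1^-(S)=\sum_{v_i\in V(G)}(d_i^-)^2$ (negative), $M_1^{\ast}(S)=\sum_{v_i\in V(G)}d_i^+d_i^-$ (mixed). Second Zagreb indices of $S$: $M_2^+(S)=\sum_{v_iv_j\in E(G)}d_i^+d_j^+$ (positive) and $M_2^-(S)=\sum_{v_iv_j\in E(G)}d_i^-d_j^-$ (negative), each edge counted once; the mixed index $M_2^{\ast}(S)$ is the sum of $d_i^+d_j^-$ over all ordered pairs $(i,j)$, $i\neq j$, with $v_iv_j\in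 E(G)$, i.e. $M_2^{\ast}(S)=\sum_{v_iv_j\in E(G)}(d_i^+d_j^-+d_i^-d_j^+)$ with each edge counted once. *)

theory Defs
  imports "Graph_Theory.Graph_Theory"
begin

text \<open>
  A finite simple undirected graph is a \<open>pair_graph\<close>: a finite, loop-free, symmetric digraph without
  parallel arcs. Each undirected edge \<open>{u, v}\<close> is represented there by the two arcs \<open>(u, v)\<close> and
  \<open>(v, u)\<close>; the following set contains it exactly once.
\<close>

definition uedges :: "'a pair_pre_digraph \<Rightarrow> 'a set set" where
  "uedges G = (\<lambda>(u, v). {u, v}) ` parcs G"

datatype sign = Positive | Negative

text \<open>
  The sign function \<open>\<sigma>\<close> of a signed graph \<open>S(G, \<sigma>)\<close> is a total function on vertex sets; only its
  values on \<^term>\<open>uedges G\<close> are ever used.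
\<close>

definition degree :: "'a pair_pre_digraph \<Rightarrow> 'a \<Rightarrow> nat" where
  "degree G v = card {e \<in> uedges G. v \<in> e}"

definition pos_degree :: "'a pair_pre_digraph \<Rightarrow> ('a set \<Rightarrow> sign) \<Rightarrow> 'a \<Rightarrow> nat" where
  "pos_degree G \<sigma> v = card {e \<in> uedges G. v \<in> e \<and> \<sigma> e = Positive}"

definition neg_degree :: "'a pair_pre_digraph \<Rightarrow> ('a set \<Rightarrow> sign) \<Rightarrow> 'a \<Rightarrow> nat" where
  "neg_degree G \<sigma> v = card {e \<in> uedges G. v \<in> e \<and> \<sigma> e = Negative}"

definition zagreb1 :: "'a pair_pre_digraph \<Rightarrow> nat" where
  "zagreb1 G = (\<Sum>v\<in>pverts G. (degree G v)\<^sup>2)"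

definition zagreb1_pos :: "'a pair_pre_digraph \<Rightarrow> ('a set \<Rightarrow> sign) \<Rightarrow> nat" where
  "zagreb1_pos G \<sigma> = (\<Sum>v\<in>pverts G. (pos_degree G \<sigma> v)\<^sup>2)"

definition zagreb1_neg :: "'a pair_pre_digraph \<Rightarrow> ('a set \<Rightarrow> sign) \<Rightarrow> nat" where
  "zagreb1_neg G \<sigma> = (\<Sum>v\<in>pverts G. (neg_degree G \<sigma> v)\<^sup>2)"

definition zagreb1_mixed :: "'a pair_pre_digraph \<Rightarrow> ('a set \<Rightarrow> sign) \<Rightarrow> nat" where
  "zagreb1_mixed G \<sigma> = (\<Sum>v\<in>pverts G. pos_degree G \<sigma> v * neg_degree G \<sigma> v)"

text \<open>
  An edge of a loop-free graph has exactly two end vertices, so the product over \<open>v \<in> e\<close> is the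
  product of the two end-vertex degrees.
\<close>

definition zagreb2 :: "'a pair_pre_digraph \<Rightarrow> nat" where
  "zagreb2 G = (\<Sum>e\<in>uedges G. \<Prod>v\<in>e. degree G v)"

definition zagreb2_pos :: "'a pair_pre_digraph \<Rightarrow> ('a set \<Rightarrow> sign) \<Rightarrow> nat" where
  "zagreb2_pos G \<sigma> = (\<Sum>e\<in>uedges G. \<Prod>v\<in>e. pos_degree G \<sigma> v)"

definition zagreb2_neg :: "'a pair_pre_digraph \<Rightarrow> ('a set \<Rightarrow> sign) \<Rightarrow> nat" where
  "zagreb2_neg G \<sigma> = (\<Sum>e\<in>uedges G. \<Prod>v\<in>e. neg_degree G \<sigma> v)"

text \<open>
  The mixed second index runs over ordered pairs of adjacent vertices, that is, over arcs: each
  edge \<open>{u, v}\<close> contributes one term for \<open>(u, v)\<close> and one for \<open>(v, u)\<close>.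
\<close>

definition zagreb2_mixed :: "'a pair_pre_digraph \<Rightarrow> ('a set \<Rightarrow> sign) \<Rightarrow> nat" where
  "zagreb2_mixed G \<sigma> = (\<Sum>(u, v)\<in>parcs G. pos_degree G \<sigma> u * neg_degree G \<sigma> v)"

end

theory Submission
  imports Defs
begin

text \<open>
  Every edge is either positive or negative, so \<open>d = d\<^sup>+ + d\<^sup>-\<close> at each vertex
  (\<open>degree_eq_pos_plus_neg\<close>). Squaring this and summing over the vertices gives the first identity.
  For the second, the product of the degrees at the two ends of an edge \<open>{u, v}\<close> expands as
  \<open>d\<^sup>+(u) d\<^sup>+(v) + d\<^sup>-(u) d\<^sup>-(v) + (d\<^sup>+(u) d\<^sup>-(v) + d\<^sup>+(v) d\<^sup>-(u))\<close>. The first two summands are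
  symmetric in \<open>u\<close> and \<open>v\<close> and belong to the edge; the bracket has one term for each of the two
  arcs \<open>(u, v)\<close> and \<open>(v, u)\<close>. Summing the brackets over the edges is therefore the same as summing
  over the arcs, which is how the mixed second index is defined.
\<close>

lemma (in pair_fin_digraph) finite_uedges: "finite (uedges G)"
  by (simp add: uedges_def)

lemma (in pair_fin_digraph) degree_eq_pos_plus_neg:
  "degree G v = pos_degree G \<sigma> v + neg_degree G \<sigma> v"
proof -
  have "{e \<in> uedges G. v \<in> e} =
      {e \<in> uedges G. v \<in> e \<and> \<sigma> e = Positive} \<union> {e \<in> uedges G. v \<in> e \<and> \<sigma> e = Negative}"
    using sign.exhaust by blast
  moreover have "{e \<in> uedges G. v \<in> e \<and> \<sigma> e = Positive} \<inter>
      {e \<in> uedges G. v \<in> e \<and> \<sigma> e = Negative} = {}"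
    by auto
  ultimately show ?thesis
    unfolding degree_def pos_degree_def neg_degree_def
    by (simp add: card_Un_disjoint finite_uedges)
qed

text \<open>
  The map \<open>(u, v) \<mapsto> {u, v}\<close> sends the arcs onto the edges, so a sum over the arcs may be taken
  fibre by fibre; symmetry of the graph makes the fibre of \<open>{u, v}\<close> the full pair of arcs
  \<open>(u, v)\<close> and \<open>(v, u)\<close>.
\<close>

lemma (in pair_graph) sum_arcs_eq_sum_uedges:
  fixes f :: "'a \<times> 'a \<Rightarrow> 'b::comm_monoid_add" and g :: "'a set \<Rightarrow> 'b"
  assumes fg: "\<And>u v. (u, v) \<in> parcs G \<Longrightarrow> g {u, v} = f (u, v) + f (v, u)"
  shows "(\<Sum>a\<in>parcs G. f a) = (\<Sum>e\<in>uedges G. g e)"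
proof -
  let ?ends = "\<lambda>(u, v). {u, v}"
  have "(\<Sum>a\<in>parcs G. f a) = (\<Sum>e\<in>uedges G. \<Sum>a | a \<in> parcs G \<and> ?ends a = e. f a)"
    unfolding uedges_def by (rule sum.image_gen) simp
  also have "\<dots> = (\<Sum>e\<in>uedges G. g e)"
  proof (rule sum.cong)
    fix e assume "e \<in> uedges G"
    then obtain u v where uv: "(u, v) \<in> parcs G" and e: "e = {u, v}"
      by (auto simp: uedges_def)
    have "u \<noteq> v" using uv no_loops' by auto
    have "{a. a \<in> parcs G \<and> ?ends a = e} = {(u, v), (v, u)}" (is "?F = _")
    proof (rule set_eqI)
      fix a show "a \<in> ?F \<longleftrightarrow> a \<in> {(u, v), (v, u)}"
        using uv arcs_symmetric[OF uv] unfolding e by (cases a) (auto simp only: mem_Collect_eq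
            prod.case doubleton_eq_iff insert_iff empty_iff prod.inject)
    qed
    then have "(\<Sum>a\<in>?F. f a) = (\<Sum>a\<in>{(u, v), (v, u)}. f a)" by (rule arg_cong)
    also have "\<dots> = f (u, v) + f (v, u)" using \<open>u \<noteq> v\<close> by simp
    also have "\<dots> = g e" unfolding e by (rule fg[OF uv, symmetric])
    finally show "(\<Sum>a\<in>?F. f a) = g e" .
  qed simp
  finally show ?thesis .
qed

lemma (in pair_fin_digraph) zagreb1_decomposition:
  "zagreb1 G = zagreb1_pos G \<sigma> + zagreb1_neg G \<sigma> + 2 * zagreb1_mixed G \<sigma>"
  unfolding zagreb1_def zagreb1_pos_def zagreb1_neg_def zagreb1_mixed_def
  by (simp add: degree_eq_pos_plus_neg[of _ \<sigma>] power2_sum sum.distrib sum_distrib_left mult.assoc)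

lemma (in pair_graph) zagreb2_decomposition:
  "zagreb2 G = zagreb2_pos G \<sigma> + zagreb2_neg G \<sigma> + zagreb2_mixed G \<sigma>"
proof -
  let ?p = "pos_degree G \<sigma>" and ?n = "neg_degree G \<sigma>"
  \<comment> \<open>The mixed part of an edge is defined as a difference of natural numbers, so that it is
    visibly a function of the edge and not of an ordering of its ends.\<close>
  define mixed where
    "mixed e = (\<Prod>v\<in>e. degree G v) - ((\<Prod>v\<in>e. ?p v) + (\<Prod>v\<in>e. ?n v))" for e
  have expand: "(\<Prod>v\<in>{u, v}. degree G v) =
      (\<Prod>v\<in>{u, v}. ?p v) + (\<Prod>v\<in>{u, v}. ?n v) + (?p u * ?n v + ?p v * ?n u)"
    if "(u, v) \<in> parcs G" for u v
  proof -
    have "u \<noteq> v" using that no_loops' by auto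
    then show ?thesis by (simp add: degree_eq_pos_plus_neg[of _ \<sigma>] algebra_simps)
  qed
  have "zagreb2_mixed G \<sigma> = (\<Sum>e\<in>uedges G. mixed e)"
    unfolding zagreb2_mixed_def
    by (rule sum_arcs_eq_sum_uedges) (simp only: mixed_def expand prod.case add_diff_cancel_left')
  moreover have "(\<Prod>v\<in>e. degree G v) = (\<Prod>v\<in>e. ?p v) + (\<Prod>v\<in>e. ?n v) + mixed e"
    if e: "e \<in> uedges G" for e
  proof -
    obtain u v where "(u, v) \<in> parcs G" "e = {u, v}"
      using e by (auto simp: uedges_def)
    then show ?thesis by (simp only: mixed_def expand add_diff_cancel_left')
  qed
  ultimately show ?thesis
    unfolding zagreb2_def zagreb2_pos_def zagreb2_neg_def by (simp add: sum.distrib)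
qed

theorem theorem1:
  fixes G :: "'a pair_pre_digraph" and \<sigma> :: "'a set \<Rightarrow> sign"
  assumes "pair_graph G" and "Digraph_Component.connected (with_proj G)"
  shows "zagreb1 G = zagreb1_pos G \<sigma> + zagreb1_neg G \<sigma> + 2 * zagreb1_mixed G \<sigma> \<and>
         zagreb2 G = zagreb2_pos G \<sigma> + zagreb2_neg G \<sigma> + zagreb2_mixed G \<sigma>"
proof -
  interpret pair_graph G by (rule assms(1))
  show ?thesis using zagreb1_decomposition zagreb2_decomposition by blast
qed

end
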